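(* Let $X$ be a Banach space, let $\delta\in(0,1]$, and let $\mathcal S_\delta=\{\mathcal S_\delta(t)\}_{t\ge 0}\subset\mathcal L(X)$ be a $C_0$--$\delta$--semigroup on $X$ with $\delta$-generator $\mathcal A_\delta$. Let $\Psi(t)=t^\delta/\delta$ and $\mathcal T(s):=\mathcal S_\delta(\Psi^{-1}(s))=\mathcal S_\delta((\delta s)^{1/\delta})$, $s\ge0$, which is a classical $C_0$-semigroup on $X$, and let $\mathcal B$ be its generator. Let $x_0\in X$ and set $x(t)=\mathcal S_\delta(t)x_0$ for $t\ge 0$. Define $$y(s):=x\bigl(\Psi^{-1}(s)\bigr)=x\bigl((\delta s)^{1/\delta}\bigr),\qquad s\ge0.$$ Then $y(s)=\mathcal T(s)x_0$ for all $s\ge 0$; hence $y$ is the classical mild solution of $y'=\mathcal B y$, $y(0)=x_0$. Conversely, if $y(s)=\mathcal T(s)x_0$ for all $s\ge0$, then $$x(t):=y(\Psi(t))=y(t^\delta/\delta),\qquad t\ge0,$$ satisfies $x(t)=\mathcal S_\delta(t)x_0$ for all $t\ge0$ and is the conformable mild solution of $\mathcal D_t^\delta x=\mathcal A_\delta x$, $x(0)=x_0$.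
   Context: $\mathcal L(X)$ denotes the bounded linear operators on $X$. A family $\{\mathcal S_\delta(t)\}_{t\ge0}\subset\mathcal L(X)$ is a conformable $\delta$--semigroup if $\mathcal S_\delta(0)=\mathrm{Id}$ and $\mathcal S_\delta((r+q)^{1/\delta})=\mathcal S_\delta(r^{1/\delta})\,\mathcal S_\delta(q^{1/\delta})$ for all $r,q\ge 0$. It is a $C_0$--$\delta$--semigroup if in addition $\lim_{t\to0^+}\mathcal S_\delta(t)x=x$ for all $x\in X$. The conformable derivative is $\mathcal D_t^\delta v(t)=\lim_{h\to0}\frac{v(t+h\,t^{1-\delta})-v(t)}{h}$, $t>0$. The $\delta$-generator of $\mathcal S_\delta$ is $\mathcal A_\delta x=\lim_{t\to0^+}\mathcal D_t^\delta\mathcal S_\delta(t)x$, with domain the set of $x\in X$ for which this limit exists. Mild solutions are defined through the evolution family: the mild solution of the conformable Cauchy problem $\mathcal D_t^\delta x(t)=\mathcal A_\delta x(t)$, $x(0)=x_0$, is the map $x(t)=\mathcal S_\delta(t)x_0$, $t\ge0$; the mild solution of the classical Cauchy problem $y'(s)=\mathcal B y(s)$, $y(0)=y_0$, is the map $y(s)=\mathcal T(s)y_0$, $s\ge 0$. *)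

theory Defs
  imports "HOL-Analysis.Analysis"
begin

definition delta_semigroup :: "real \<Rightarrow> (real \<Rightarrow> 'a::banach \<Rightarrow>\<^sub>L 'a) \<Rightarrow> bool" where
  "delta_semigroup \<delta> S \<longleftrightarrow>
     S 0 = id_blinfun \<and>
     (\<forall>r\<ge>0. \<forall>q\<ge>0. S ((r + q) powr (1 / \<delta>)) = S (r powr (1 / \<delta>)) o\<^sub>L S (q powr (1 / \<delta>)))"

definition C0_delta_semigroup :: "real \<Rightarrow> (real \<Rightarrow> 'a::banach \<Rightarrow>\<^sub>L 'a) \<Rightarrow> bool" where
  "C0_delta_semigroup \<delta> S \<longleftrightarrow>
     delta_semigroup \<delta> S \<and> (\<forall>x. ((\<lambda>t. blinfun_apply (S t) x) \<longlongrightarrow> x) (at_right 0))"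

definition C0_semigroup :: "(real \<Rightarrow> 'a::banach \<Rightarrow>\<^sub>L 'a) \<Rightarrow> bool" where
  "C0_semigroup T \<longleftrightarrow>
     T 0 = id_blinfun \<and>
     (\<forall>r\<ge>0. \<forall>q\<ge>0. T (r + q) = T r o\<^sub>L T q) \<and>
     (\<forall>x. ((\<lambda>t. blinfun_apply (T t) x) \<longlongrightarrow> x) (at_right 0))"

definition has_conformable_derivative ::
    "real \<Rightarrow> (real \<Rightarrow> 'a::banach) \<Rightarrow> 'a \<Rightarrow> real \<Rightarrow> bool" where
  "has_conformable_derivative \<delta> v d t \<longleftrightarrow>
     ((\<lambda>h. (v (t + h * t powr (1 - \<delta>)) - v t) /\<^sub>R h) \<longlongrightarrow> d) (at 0)"

text \<open>Unbounded operators are represented by their graphs, so that the domain of \<open>A\<close> is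
  \<open>Domain A\<close> and equality of operators includes equality of their domains.\<close>

definition delta_generator :: "real \<Rightarrow> (real \<Rightarrow> 'a::banach \<Rightarrow>\<^sub>L 'a) \<Rightarrow> ('a \<times> 'a) set" where
  "delta_generator \<delta> S =
     {(x, z). \<exists>g. (\<forall>\<^sub>F t in at_right 0.
                      has_conformable_derivative \<delta> (\<lambda>r. blinfun_apply (S r) x) (g t) t) \<and>
                  (g \<longlongrightarrow> z) (at_right 0)}"

definition generator :: "(real \<Rightarrow> 'a::banach \<Rightarrow>\<^sub>L 'a) \<Rightarrow> ('a \<times> 'a) set" where
  "generator T = {(x, z). ((\<lambda>h. (blinfun_apply (T h) x - x) /\<^sub>R h) \<longlongrightarrow> z) (at_right 0)}"

text \<open>A mild solution is the orbit of the initial value under the evolution family generated by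
  the operator of the Cauchy problem; only its values at nonnegative times matter.\<close>

definition conformable_mild_solution ::
    "real \<Rightarrow> ('a::banach \<times> 'a) set \<Rightarrow> 'a \<Rightarrow> (real \<Rightarrow> 'a) \<Rightarrow> bool" where
  "conformable_mild_solution \<delta> A x0 x \<longleftrightarrow>
     (\<exists>S. C0_delta_semigroup \<delta> S \<and> delta_generator \<delta> S = A \<and>
          (\<forall>t\<ge>0. x t = blinfun_apply (S t) x0))"

definition mild_solution ::
    "('a::banach \<times> 'a) set \<Rightarrow> 'a \<Rightarrow> (real \<Rightarrow> 'a) \<Rightarrow> bool" where
  "mild_solution B y0 y \<longleftrightarrow>
     (\<exists>T. C0_semigroup T \<and> generator T = B \<and>
          (\<forall>s\<ge>0. y s = blinfun_apply (T s) y0))"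

definition Psi :: "real \<Rightarrow> real \<Rightarrow> real" where
  "Psi \<delta> t = t powr \<delta> / \<delta>"

definition Psi_inv :: "real \<Rightarrow> real \<Rightarrow> real" where
  "Psi_inv \<delta> = the_inv_into {0..} (Psi \<delta>)"

lemma Psi_inv_eq:
  assumes "0 < \<delta>" "0 \<le> s"
  shows "Psi_inv \<delta> s = (\<delta> * s) powr (1 / \<delta>)"
  unfolding Psi_inv_def
proof (rule the_inv_into_f_eq)
  show "inj_on (Psi \<delta>) {0..}"
  proof (rule inj_onI)
    fix x y assume "x \<in> {0..}" "y \<in> {0..}" "Psi \<delta> x = Psi \<delta> y"
    then have "(x powr \<delta>) powr (1 / \<delta>) = (y powr \<delta>) powr (1 / \<delta>)"
      using assms by (simp add: Psi_def)
    then show "x = y"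
      using assms \<open>x \<in> {0..}\<close> \<open>y \<in> {0..}\<close> by (simp add: powr_powr)
  qed
  show "Psi \<delta> ((\<delta> * s) powr (1 / \<delta>)) = s"
    using assms by (simp add: Psi_def powr_powr)
qed simp

end

theory Submission
  imports Defs
begin

text \<open>The time change \<open>Psi\<close> maps [0,\<infinity>) bijectively onto itself and
  straightens the \<delta>-semigroup law: its inverse sends s to the (1/\<delta>)-th power of
  \<delta>s, so adding s-times adds the arguments under that power. Hence \<open>T\<close> is a
  C0-semigroup (\<open>C0_semigroup_rescale\<close>). As mild solutions are orbits, both directions
  are then substitutions: \<open>T\<close> witnesses the classical notion, and \<open>S\<close> the
  conformable one once \<open>Psi_inv_Psi\<close> cancels the time change.\<close>

lemma Psi_inv_Psi:
  assumes "0 < \<delta>" "0 \<le> t"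
  shows "Psi_inv \<delta> (Psi \<delta> t) = t"
proof -
  have "0 \<le> Psi \<delta> t"
    using assms by (simp add: Psi_def)
  then show ?thesis
    \<comment> \<open>\<open>Psi\<close> stays folded at first so that the nonnegativity fact
      discharges the side condition of \<open>Psi_inv_eq\<close>; only then do the powers
      collapse.\<close>
    using assms by (simp add: Psi_inv_eq) (simp add: Psi_def powr_powr)
qed

text \<open>This carries strong continuity at 0 from \<open>S\<close> to \<open>T\<close>. Besides
  convergence to 0, it needs positive times to stay positive.\<close>

lemma filterlim_Psi_inv_at_right_0:
  assumes "0 < \<delta>"
  shows "filterlim (Psi_inv \<delta>) (at_right 0) (at_right 0)"
proof -
  \<comment> \<open>The base tends to 0, where \<open>powr\<close> is continuous because the
    exponent is positive and the base is eventually nonnegative.\<close>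
  have "((\<lambda>s. (\<delta> * s) powr (1 / \<delta>)) \<longlongrightarrow> (\<delta> * 0) powr (1 / \<delta>)) (at_right 0)"
    using assms
    by (intro tendsto_powr2 tendsto_intros)
      (auto simp: eventually_at_filter)
  then have "filterlim (\<lambda>s. (\<delta> * s) powr (1 / \<delta>)) (at_right 0) (at_right 0)"
    using assms by (auto simp: filterlim_at eventually_at_filter)
  moreover have "\<forall>\<^sub>F s in at_right 0. (\<delta> * s) powr (1 / \<delta>) = Psi_inv \<delta> s"
    using assms by (auto simp: eventually_at_filter Psi_inv_eq)
  ultimately show ?thesis
    by (simp only: filterlim_cong[OF refl refl])
qed

lemma C0_semigroup_rescale:
  assumes \<delta>: "0 < \<delta>" and S: "C0_delta_semigroup \<delta> S"
    and T: "\<And>s. 0 \<le> s \<Longrightarrow> T s = S (Psi_inv \<delta> s)"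
  shows "C0_semigroup T"
  unfolding C0_semigroup_def
proof (intro conjI allI impI)
  show "T 0 = id_blinfun"
    using S \<delta> by (simp add: T Psi_inv_eq C0_delta_semigroup_def delta_semigroup_def)
next
  fix r q :: real
  assume "0 \<le> r" "0 \<le> q"
  \<comment> \<open>The \<delta>-law is used at \<delta>r and \<delta>q, whose sum is \<delta>(r +
    q).\<close>
  then have "S ((\<delta> * r + \<delta> * q) powr (1 / \<delta>)) =
      S ((\<delta> * r) powr (1 / \<delta>)) o\<^sub>L S ((\<delta> * q) powr (1 / \<delta>))"
    using S \<delta> by (simp add: C0_delta_semigroup_def delta_semigroup_def)
  then show "T (r + q) = T r o\<^sub>L T q"
    using \<delta> \<open>0 \<le> r\<close> \<open>0 \<le> q\<close> by (simp add: T Psi_inv_eq distrib_left)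
next
  fix x
  have "((\<lambda>t. blinfun_apply (S t) x) \<longlongrightarrow> x) (at_right 0)"
    using S by (simp add: C0_delta_semigroup_def)
  then have "((\<lambda>s. blinfun_apply (S (Psi_inv \<delta> s)) x) \<longlongrightarrow> x) (at_right 0)"
    using filterlim_Psi_inv_at_right_0[OF \<delta>] by (rule filterlim_compose)
  \<comment> \<open>\<open>T\<close> is prescribed only at nonnegative times, which suffices for a
    right-hand limit.\<close>
  moreover have "\<forall>\<^sub>F s in at_right 0. T s = S (Psi_inv \<delta> s)"
    by (auto simp: eventually_at_filter T)
  ultimately show "((\<lambda>s. blinfun_apply (T s) x) \<longlongrightarrow> x) (at_right 0)"
    by (rule Lim_transform_eventually[OF _ eventually_mono]) simp
qed

theorem proposition6:
  fixes \<delta> :: real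
    and S T :: "real \<Rightarrow> 'a::banach \<Rightarrow>\<^sub>L 'a"
    and A B :: "('a \<times> 'a) set"
    and x0 :: 'a
  assumes "0 < \<delta>" and "\<delta> \<le> 1"
    and "C0_delta_semigroup \<delta> S"
    and "A = delta_generator \<delta> S"
    and "\<And>s. 0 \<le> s \<Longrightarrow> T s = S (Psi_inv \<delta> s)"
    and "B = generator T"
  shows "C0_semigroup T \<and>
    (\<forall>s\<ge>0. T s = S ((\<delta> * s) powr (1 / \<delta>))) \<and>
    (\<forall>x y. (\<forall>t\<ge>0. x t = blinfun_apply (S t) x0) \<longrightarrow>
           (\<forall>s\<ge>0. y s = x (Psi_inv \<delta> s)) \<longrightarrow>
             (\<forall>s\<ge>0. y s = x ((\<delta> * s) powr (1 / \<delta>))) \<and>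
             (\<forall>s\<ge>0. y s = blinfun_apply (T s) x0) \<and>
             mild_solution B x0 y) \<and>
    (\<forall>x y. (\<forall>s\<ge>0. y s = blinfun_apply (T s) x0) \<longrightarrow>
           (\<forall>t\<ge>0. x t = y (Psi \<delta> t)) \<longrightarrow>
             (\<forall>t\<ge>0. x t = blinfun_apply (S t) x0) \<and>
             conformable_mild_solution \<delta> A x0 x)"
proof (intro conjI allI impI)
  show C0: "C0_semigroup T"
    using assms(1,3,5) by (rule C0_semigroup_rescale)
  show "T s = S ((\<delta> * s) powr (1 / \<delta>))" if "0 \<le> s" for s
    using that assms(1,5) by (simp add: Psi_inv_eq)
next
  fix x y :: "real \<Rightarrow> 'a" and s :: real
  assume y: "\<forall>s\<ge>0. y s = x (Psi_inv \<delta> s)" and "0 \<le> s"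
  then show "y s = x ((\<delta> * s) powr (1 / \<delta>))"
    using assms(1) by (simp add: Psi_inv_eq)
next
  fix x y :: "real \<Rightarrow> 'a"
  assume "\<forall>t\<ge>0. x t = blinfun_apply (S t) x0" "\<forall>s\<ge>0. y s = x (Psi_inv \<delta> s)"
  then have y: "y s = blinfun_apply (T s) x0" if "0 \<le> s" for s
    using that assms(1,5) by (simp add: Psi_inv_eq)
  then show "y s = blinfun_apply (T s) x0" if "0 \<le> s" for s
    using that .
  show "mild_solution B x0 y"
    using y assms(6) C0_semigroup_rescale[OF assms(1,3,5)]
    unfolding mild_solution_def by blast
next
  fix x y :: "real \<Rightarrow> 'a"
  assume yx: "\<forall>s\<ge>0. y s = blinfun_apply (T s) x0" "\<forall>t\<ge>0. x t = y (Psi \<delta> t)"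
  have x: "x t = blinfun_apply (S t) x0" if "0 \<le> t" for t
  proof -
    \<comment> \<open>The equations for \<open>y\<close> and \<open>T\<close> hold only at
      nonnegative times, so this licenses their use at \<open>Psi \<delta> t\<close>.\<close>
    have "0 \<le> Psi \<delta> t"
      using assms(1) by (simp add: Psi_def)
    then show ?thesis
      using that yx assms(1,5) by (simp add: Psi_inv_Psi)
  qed
  then show "x t = blinfun_apply (S t) x0" if "0 \<le> t" for t
    using that .
  show "conformable_mild_solution \<delta> A x0 x"
    using x assms(3,4) unfolding conformable_mild_solution_def by blast
qed

end
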